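(* For every positive integer $n$, the slow Tamari lattice $\operatorname{sTam}_n$ has exactly $(n-1)^2$ meet-irreducible elements and exactly $(n-1)^2$ join-irreducible elements.
   Context: Let $n$ be a positive integer. The board of size $n$ is the Ferrers diagram of shape $(n,n,n-1,n-2,\dots,3,2)$ (a single cell $(1,1)$ if $n=1$). Its cells are written $(i,j)$, where $i$ is the row, numbered from the top, and $j$ is the column label, the columns being labelled $n,n-1,\dots,1$ from left to right. So the cells are $(1,j)$ for $1\le j\le n$ and $(i,j)$ for $2\le i\le n$, $i-1\le j\le n$. The root is $(1,n)$ (top-left cell); the border cells are $(i,i-1)$ for $2\le i\le n$ (the rightmost cells of rows $2,\dots,n$). An fb-tableau of size $n$ is a filling in which each cell is either empty or nonempty such that the root and all border cells are nonempty, and every nonempty cell other than the root has a nonempty cell strictly to its left in the same row or strictly above it in the same column. In an fb-tableau, a nonempty cell different from the root is called a left-arrow if there is no nonempty cell strictly to its left in its row, an up-arrow if there is no nonempty cell strictly above it in its column, and a dot otherwise; the root is also a dot. (Each of rows $2,\dots,n$ has exactly one left-arrow, each of columns $1,\dots,n-1$ has exactly one up-arrow.) A cell is free in $T$ if it lies strictly below an up-arrow (same column) and strictly to the right of a left-arrow (same row); a free cell is either empty or contains a dot. $\operatorname{Row}(T)$ is the set of cells lying weakly to the right of a left-arrow or of the root in the same row; $\operatorname{Col}(T)$ is the set of cells lying weakly below an up-arrow or the root in the same column. For fb-tableaux $S,T$ of size $n$, write $S\lhd T$ if (1) $\operatorname{Col}(S)\subseteq\operatorname{Col}(T)$; (2)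 $\operatorname{Row}(T)\subseteq\operatorname{Row}(S)$; (3) for every cell $c$ that is free in both $S$ and $T$, if $c$ contains a dot in $S$ then $c$ contains a dot in $T$. An fb-tableau is small if its only dot is the root (equivalently, all its free cells are empty). The slow Tamari lattice $\operatorname{sTam}_n$ is the set of small fb-tableaux of size $n$ ordered by $\lhd$; it is a finite lattice. An element is join-irreducible (resp. meet-irreducible) if it covers (resp. is covered by) exactly one element. *)

theory Defs
  imports Main
begin

text \<open>
  A cell is a pair of its row index, counted from the top, and its column label. The columns are
  labelled n, ..., 1 from left to right, so larger labels lie further to the left.
\<close>

type_synonym cell = "nat \<times> nat"

definition left_of :: "cell \<Rightarrow> cell \<Rightarrow> bool" where
  "left_of c d \<longleftrightarrow> fst c = fst d \<and> snd d < snd c"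

definition above :: "cell \<Rightarrow> cell \<Rightarrow> bool" where
  "above c d \<longleftrightarrow> snd c = snd d \<and> fst c < fst d"

definition board :: "nat \<Rightarrow> cell set" where
  "board n = {(1, j) | j. 1 \<le> j \<and> j \<le> n} \<union> {(i, j) | i j. 2 \<le> i \<and> i \<le> n \<and> i - 1 \<le> j \<and> j \<le> n}"

definition root :: "nat \<Rightarrow> cell" where
  "root n = (1, n)"

definition border :: "nat \<Rightarrow> cell set" where
  "border n = {(i, i - 1) | i. 2 \<le> i \<and> i \<le> n}"

text \<open>A filling is represented by the set of its nonempty cells.\<close>

definition fb_tableau :: "nat \<Rightarrow> cell set \<Rightarrow> bool" where
  "fb_tableau n T \<longleftrightarrow>
     T \<subseteq> board n \<and> root n \<in> T \<and> border n \<subseteq> T \<and>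
     (\<forall>c\<in>T - {root n}. \<exists>d\<in>T. left_of d c \<or> above d c)"

definition left_arrow :: "nat \<Rightarrow> cell set \<Rightarrow> cell \<Rightarrow> bool" where
  "left_arrow n T c \<longleftrightarrow> c \<in> T \<and> c \<noteq> root n \<and> \<not> (\<exists>d\<in>T. left_of d c)"

definition up_arrow :: "nat \<Rightarrow> cell set \<Rightarrow> cell \<Rightarrow> bool" where
  "up_arrow n T c \<longleftrightarrow> c \<in> T \<and> c \<noteq> root n \<and> \<not> (\<exists>d\<in>T. above d c)"

text \<open>The root is neither kind of arrow by definition, hence it counts as a dot.\<close>

definition dot :: "nat \<Rightarrow> cell set \<Rightarrow> cell \<Rightarrow> bool" where
  "dot n T c \<longleftrightarrow> c \<in> T \<and> \<not> left_arrow n T c \<and> \<not> up_arrow n T c"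

definition free_cell :: "nat \<Rightarrow> cell set \<Rightarrow> cell \<Rightarrow> bool" where
  "free_cell n T c \<longleftrightarrow>
     c \<in> board n \<and> (\<exists>u. up_arrow n T u \<and> above u c) \<and> (\<exists>l. left_arrow n T l \<and> left_of l c)"

definition Row :: "nat \<Rightarrow> cell set \<Rightarrow> cell set" where
  "Row n T = {c \<in> board n. \<exists>d. (left_arrow n T d \<or> d = root n) \<and> (d = c \<or> left_of d c)}"

definition Col :: "nat \<Rightarrow> cell set \<Rightarrow> cell set" where
  "Col n T = {c \<in> board n. \<exists>d. (up_arrow n T d \<or> d = root n) \<and> (d = c \<or> above d c)}"

definition fb_le :: "nat \<Rightarrow> cell set \<Rightarrow> cell set \<Rightarrow> bool" where
  "fb_le n S T \<longleftrightarrow>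
     Col n S \<subseteq> Col n T \<and> Row n T \<subseteq> Row n S \<and>
     (\<forall>c. free_cell n S c \<and> free_cell n T c \<and> dot n S c \<longrightarrow> dot n T c)"

definition small :: "nat \<Rightarrow> cell set \<Rightarrow> bool" where
  "small n T \<longleftrightarrow> fb_tableau n T \<and> {c. dot n T c} = {root n}"

definition sTam :: "nat \<Rightarrow> cell set set" where
  "sTam n = {T. small n T}"

text \<open>
  \<open>covers_in A le y x\<close> says that y covers x in the set A ordered by the non-strict relation le.
\<close>

definition covers_in :: "'a set \<Rightarrow> ('a \<Rightarrow> 'a \<Rightarrow> bool) \<Rightarrow> 'a \<Rightarrow> 'a \<Rightarrow> bool" where
  "covers_in A le y x \<longleftrightarrow>
     x \<in> A \<and> y \<in> A \<and> le x y \<and> x \<noteq> y \<and>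
     \<not> (\<exists>z\<in>A. z \<noteq> x \<and> z \<noteq> y \<and> le x z \<and> le z y)"

definition join_irreducibles :: "'a set \<Rightarrow> ('a \<Rightarrow> 'a \<Rightarrow> bool) \<Rightarrow> 'a set" where
  "join_irreducibles A le = {x \<in> A. \<exists>!y. covers_in A le x y}"

definition meet_irreducibles :: "'a set \<Rightarrow> ('a \<Rightarrow> 'a \<Rightarrow> bool) \<Rightarrow> 'a set" where
  "meet_irreducibles A le = {x \<in> A. \<exists>!y. covers_in A le y x}"

end

theory Submission
  imports Defs
begin

text \<open>
  In a small tableau, row \<open>k + 1\<close> and column \<open>k\<close> meet in a border cell, which is exactly one of
  a left-arrow and an up-arrow. So for each \<open>k\<close> with \<open>0 < k < n\<close> only one arrow is not prescribed:
  either the up-arrow of column \<open>k\<close>, in a row \<open>v k \<le> k\<close>, or the left-arrow of row \<open>k + 1\<close>, in a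
  column \<open>v k > k\<close>. The order \<open>\<lhd>\<close> becomes the reversed pointwise order on the vectors \<open>v\<close>,
  and a vector comes from a small tableau iff for \<open>k < m\<close> one has
  \<open>v m = k + 1 \<Longrightarrow> m < v k\<close> and \<open>v k = m \<Longrightarrow> v m \<le> k\<close>.

  For \<open>0 < k < n\<close> and \<open>2 \<le> c \<le> n\<close> there is a least vector with \<open>v k = c\<close>. Each of these
  \<open>(n - 1)\<^sup>2\<close> vectors has a greatest vector strictly below it, and every vector is the pointwise
  supremum of those of them which lie below it, so they are the irreducibles on one side. The
  involution \<open>v k \<mapsto> n + 1 - v (n - k)\<close> reverses the order and gives the other side.
\<close>

section \<open>Irreducible elements and order isomorphisms\<close>

lemma meet_irreducibles_converse:
  "meet_irreducibles A (\<lambda>x y. le y x) = join_irreducibles A le"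
proof -
  have "covers_in A (\<lambda>x y. le y x) y x \<longleftrightarrow> covers_in A le x y" for x y
    unfolding covers_in_def by blast
  then show ?thesis
    unfolding meet_irreducibles_def join_irreducibles_def by simp
qed

lemma covers_in_iso:
  assumes "bij_betw f A B"
    and le: "\<And>x y. x \<in> A \<Longrightarrow> y \<in> A \<Longrightarrow> le x y \<longleftrightarrow> le' (f x) (f y)"
    and x: "x \<in> A" and y: "y \<in> A"
  shows "covers_in A le x y \<longleftrightarrow> covers_in B le' (f x) (f y)"
proof -
  have B: "B = f ` A" and inj: "inj_on f A"
    using assms(1) by (auto simp: bij_betw_def)
  have "z \<in> A \<Longrightarrow> f z = f w \<longleftrightarrow> z = w" if "w \<in> A" for z w
    using inj that by (auto dest: inj_onD)
  then show ?thesis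
    using x y by (simp add: covers_in_def B le)
qed

text \<open>Order-reversing bijections are covered too: one of the two relations is then taken with
  its arguments swapped.\<close>

lemma card_join_irreducibles_iso:
  assumes bij: "bij_betw f A B"
    and le: "\<And>x y. x \<in> A \<Longrightarrow> y \<in> A \<Longrightarrow> le x y \<longleftrightarrow> le' (f x) (f y)"
  shows "card (join_irreducibles A le) = card (join_irreducibles B le')"
proof -
  have B: "B = f ` A" and inj: "inj_on f A"
    using bij by (auto simp: bij_betw_def)
  have unique: "(\<exists>!y. covers_in A le x y) \<longleftrightarrow> (\<exists>!y. covers_in B le' (f x) y)" if "x \<in> A" for x
  proof -
    \<comment> \<open>Unique existence ranges over the whole type, so membership in \<open>A\<close>
      is made explicit before lower covers are transported along \<open>f\<close>.\<close>
    have A: "covers_in A le x y \<longleftrightarrow> y \<in> A \<and> covers_in B le' (f x) (f y)" for y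
      using covers_in_iso[of f A B le le' x y] bij le that by (auto simp: covers_in_def)
    have image: "y \<in> f ` A" if "covers_in B le' (f x) y" for y
      using that by (simp add: covers_in_def B)
    show ?thesis
      unfolding A
    proof
      assume "\<exists>!y. y \<in> A \<and> covers_in B le' (f x) (f y)"
      then show "\<exists>!y. covers_in B le' (f x) y"
        using image by blast
    next
      assume "\<exists>!y. covers_in B le' (f x) y"
      then show "\<exists>!y. y \<in> A \<and> covers_in B le' (f x) (f y)"
        using image inj_onD[OF inj] by blast
    qed
  qed
  have iff: "f x \<in> join_irreducibles B le' \<longleftrightarrow> x \<in> join_irreducibles A le" if "x \<in> A" for x
    using unique[OF that] that by (simp add: join_irreducibles_def B)
  have sub: "join_irreducibles B le' \<subseteq> f ` A" "join_irreducibles A le \<subseteq> A"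
    unfolding join_irreducibles_def B by (rule Collect_restrict)+
  have "join_irreducibles B le' = f ` join_irreducibles A le"
    using iff sub by blast
  moreover have "inj_on f (join_irreducibles A le)"
    using inj sub(2) by (rule inj_on_subset)
  ultimately show ?thesis
    by (simp add: card_image)
qed

text \<open>A greatest element strictly below \<open>x\<close> is the only lower cover of
  \<open>x\<close>.\<close>

lemma join_irreducibleI:
  fixes x :: "'a::order"
  assumes "x \<in> A" "y \<in> A" "y < x" "\<And>z. z \<in> A \<Longrightarrow> z < x \<Longrightarrow> z \<le> y"
  shows "x \<in> join_irreducibles A (\<le>)"
proof -
  have "covers_in A (\<le>) x y"
    using assms by (auto simp: covers_in_def) (metis order.antisym order.strict_iff_order)
  moreover have "z = y" if "covers_in A (\<le>) x z" for z
    using that assms unfolding covers_in_def by (metis order.strict_iff_order)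
  ultimately show ?thesis
    using assms(1) unfolding join_irreducibles_def by blast
qed

text \<open>A maximal element of the finite half-open interval from \<open>z\<close> to
  \<open>x\<close> is a lower cover of \<open>x\<close>. Hence, if \<open>x\<close> has a single
  lower cover, everything strictly below \<open>x\<close> lies below that cover.\<close>

lemma lower_cover_above:
  fixes x :: "'a::order"
  assumes "finite A" "x \<in> A" "z \<in> A" "z < x"
  obtains y where "covers_in A (\<le>) x y" "z \<le> y"
proof -
  let ?B = "{y \<in> A. z \<le> y \<and> y < x}"
  have "finite ?B" "z \<in> ?B"
    using assms by auto
  then obtain y where "y \<in> ?B" "\<forall>w\<in>?B. y \<le> w \<longrightarrow> y = w"
    using finite_has_maximal[of ?B] by auto
  then have "covers_in A (\<le>) x y" "z \<le> y"
    using assms(2) by (auto simp: covers_in_def order.strict_iff_order)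
  then show ?thesis
    by (rule that)
qed

section \<open>The poset of vectors\<close>

text \<open>The value 0 outside the index range only makes vectors extensional.\<close>

definition vectors :: "nat \<Rightarrow> (nat \<Rightarrow> nat) set" where
  "vectors n = {v.
     (\<forall>k. 0 < k \<and> k < n \<longrightarrow> 1 \<le> v k \<and> v k \<le> n) \<and>
     (\<forall>k. \<not> (0 < k \<and> k < n) \<longrightarrow> v k = 0) \<and>
     (\<forall>k m. 0 < k \<and> k < m \<and> m < n \<longrightarrow>
        (v m = Suc k \<longrightarrow> m < v k) \<and> (v k = m \<longrightarrow> v m \<le> k))}"

lemma vectors_range:
  assumes "v \<in> vectors n" "0 < k" "k < n"
  shows "1 \<le> v k" "v k \<le> n"
  using assms unfolding vectors_def by blast+

lemma vectors_outside:
  assumes "v \<in> vectors n" "\<not> (0 < k \<and> k < n)"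
  shows "v k = 0"
  using assms unfolding vectors_def by blast

lemma vectors_up:
  assumes "v \<in> vectors n" "0 < k" "k < m" "m < n" "v m = Suc k"
  shows "m < v k"
  using assms by (auto simp: vectors_def)

lemma vectors_left:
  assumes "v \<in> vectors n" "0 < k" "k < m" "m < n" "v k = m"
  shows "v m \<le> k"
  using assms by (auto simp: vectors_def)

lemma vectors_le_iff:
  assumes "v \<in> vectors n"
  shows "v \<le> w \<longleftrightarrow> (\<forall>k. 0 < k \<and> k < n \<longrightarrow> v k \<le> w k)"
  using assms by (auto simp: le_fun_def) (metis vectors_outside le0)

lemma finite_vectors: "finite (vectors n)"
proof (rule finite_subset)
  show "vectors n \<subseteq> {v. \<forall>k. (k \<in> {..<n} \<longrightarrow> v k \<in> {..n}) \<and> (k \<notin> {..<n} \<longrightarrow> v k = 0)}"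
  proof clarify
    fix v k assume v: "v \<in> vectors n"
    show "(k \<in> {..<n} \<longrightarrow> v k \<in> {..n}) \<and> (k \<notin> {..<n} \<longrightarrow> v k = 0)"
      using vectors_range[OF v, of k] vectors_outside[OF v, of k] by (cases "k = 0") auto
  qed
qed (rule finite_set_of_finite_funs; simp)

text \<open>
  The least vector with value \<open>c\<close> at \<open>k\<close>. For \<open>c = 1\<close> it is the bottom element, because the index
  \<open>c - 1 = 0\<close> is out of range.
\<close>

definition least_vec :: "nat \<Rightarrow> nat \<Rightarrow> nat \<Rightarrow> nat \<Rightarrow> nat" where
  "least_vec n k c = (\<lambda>i. if 0 < i \<and> i < n then
     if i = k then c else if c \<le> k \<and> Suc i = c then Suc k else 1 else 0)"

section \<open>Least vectors with a prescribed entry\<close>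

lemma least_vec_in_vectors:
  assumes "0 < k" "k < n" "0 < c" "c \<le> n"
  shows "least_vec n k c \<in> vectors n"
  using assms by (auto simp: vectors_def least_vec_def)

text \<open>If \<open>v k = Suc i\<close> with \<open>0 < i < k\<close>, then
  \<open>vectors_up\<close> forces \<open>v i\<close> to be at least \<open>Suc k\<close>. This is
  the origin of the second entry above 1 in \<open>least_vec\<close>; the remaining entries in range
  are 1, the smallest possible value.\<close>

lemma least_vec_le:
  assumes v: "v \<in> vectors n" and k: "0 < k" "k < n"
  shows "least_vec n k (v k) \<le> v"
proof -
  have "least_vec n k (v k) i \<le> v i" for i
    using vectors_range[OF v] vectors_outside[OF v] vectors_up[OF v, of i k] k
    by (auto simp: least_vec_def Suc_le_eq)
  then show ?thesis
    by (simp add: le_fun_def)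
qed

text \<open>Take \<open>k\<close> to be a coordinate at which the unique lower cover
  \<open>y\<close> of \<open>x\<close> is smaller than \<open>x\<close>. The least vector with value
  \<open>x k\<close> at \<open>k\<close> is below \<open>x\<close> but not below \<open>y\<close>,
  so it cannot be strictly below \<open>x\<close>.\<close>

lemma vectors_eq_least_vec:
  assumes x: "x \<in> join_irreducibles (vectors n) (\<le>)"
  obtains k where "0 < k" "k < n" "2 \<le> x k" "x = least_vec n k (x k)"
proof -
  have xv: "x \<in> vectors n"
    using x by (simp add: join_irreducibles_def)
  obtain y where y: "covers_in (vectors n) (\<le>) x y"
    and uniq: "\<And>z. covers_in (vectors n) (\<le>) x z \<Longrightarrow> z = y"
    using x unfolding join_irreducibles_def by blast
  have yv: "y \<in> vectors n" and "y \<le> x" "y \<noteq> x"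
    using y by (auto simp: covers_in_def)
  then have "\<not> x \<le> y"
    by auto
  then obtain k where k: "0 < k" "k < n" "y k < x k"
    using vectors_le_iff[OF xv] by (auto simp: not_le)
  have "2 \<le> x k"
    using k vectors_range[OF yv k(1,2)] by linarith
  have "x = least_vec n k (x k)"
  proof (rule ccontr)
    assume "x \<noteq> least_vec n k (x k)"
    then have "least_vec n k (x k) < x"
      using least_vec_le[OF xv k(1,2)] by (simp add: order.strict_iff_order)
    moreover have "least_vec n k (x k) \<in> vectors n"
      using k vectors_range[OF xv k(1,2)] by (intro least_vec_in_vectors) auto
    ultimately have "least_vec n k (x k) \<le> y"
      using lower_cover_above[OF finite_vectors xv] uniq by metis
    then have "x k \<le> y k"
      using k by (auto simp: le_fun_def least_vec_def dest: spec[of _ k])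
    then show False
      using k by simp
  qed
  with k \<open>2 \<le> x k\<close> show ?thesis
    by (intro that)
qed

text \<open>For \<open>k < c\<close> the vector is 1 at all other indices in range. Its entry at
  \<open>k\<close> drops by one, except that from \<open>Suc k\<close> it falls directly to 1: the
  values from 2 to \<open>k\<close> would force another entry above 1.\<close>

lemma below_least_vec_left:
  assumes z: "z \<in> vectors n" and k: "0 < k" "k < c" "c \<le> n"
    and less: "z < least_vec n k c"
  shows "z \<le> least_vec n k (if c = Suc k then 1 else c - 1)"
proof -
  have le: "z i \<le> least_vec n k c i" for i
    using less by (simp add: less_fun_def le_fun_def)
  have other: "z i = 1" if "0 < i" "i < n" "i \<noteq> k" for i
    using le[of i] that k vectors_range[OF z, of i] by (auto simp: least_vec_def)
  have "z k \<noteq> c"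
  proof
    assume "z k = c"
    then have "least_vec n k c \<le> z"
      using least_vec_le[OF z, of k] k by simp
    with less show False
      by auto
  qed
  moreover have "z k \<le> c"
    using le[of k] by (auto simp: least_vec_def split: if_splits)
  \<comment> \<open>An entry \<open>Suc j\<close> at \<open>k\<close> with \<open>0 < j < k\<close>
    would require \<open>k < z j\<close>, while \<open>z j = 1\<close>.\<close>
  moreover have "z k = 1" if "z k \<le> k"
  proof (rule ccontr)
    assume "z k \<noteq> 1"
    then obtain j where j: "z k = Suc j" "0 < j"
      using vectors_range[OF z, of k] k by (cases "z k") auto
    then have "k < z j"
      using vectors_up[OF z, of j k] that k by simp
    then show False
      using other[of j] that j k by auto
  qed
  ultimately have "z k \<le> (if c = Suc k then 1 else c - 1)"
    by (cases "z k \<le> k") auto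
  then show ?thesis
    using other k by (auto simp: vectors_le_iff[OF z] least_vec_def)
qed

text \<open>For \<open>c \<le> k\<close> there are two entries above 1: \<open>c\<close> at
  \<open>k\<close>, and \<open>Suc k\<close> at \<open>c - 1\<close>. Lowering the entry at
  \<open>k\<close> makes it fall to 1, while the entry at \<open>c - 1\<close> can stay; what
  remains is the least vector with value \<open>Suc k\<close> at \<open>c - 1\<close>.\<close>

lemma below_least_vec_up:
  assumes z: "z \<in> vectors n" and k: "2 \<le> c" "c \<le> k" "k < n"
    and less: "z < least_vec n k c"
  shows "z \<le> least_vec n (c - 1) (Suc k)"
proof -
  have le: "z i \<le> least_vec n k c i" for i
    using less by (simp add: less_fun_def le_fun_def)
  have other: "z i = 1" if "0 < i" "i < n" "i \<noteq> k" "Suc i \<noteq> c" for i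
    using le[of i] that vectors_range[OF z, of i] by (auto simp: least_vec_def)
  have "z k \<noteq> c"
  proof
    assume "z k = c"
    then have "least_vec n k c \<le> z"
      using least_vec_le[OF z, of k] k by simp
    with less show False
      by auto
  qed
  then have "z k < c"
    using le[of k] k by (auto simp: least_vec_def split: if_splits)
  \<comment> \<open>A value \<open>Suc j\<close> with \<open>0 < j\<close> and
    \<open>Suc j < c\<close> would require \<open>k < z j\<close>, but \<open>z\<close> is 1 at such
    an index \<open>j\<close>.\<close>
  have "z k = 1"
  proof (rule ccontr)
    assume "z k \<noteq> 1"
    then obtain j where j: "z k = Suc j" "0 < j"
      using vectors_range[OF z, of k] k by (cases "z k") auto
    then have "k < z j"
      using vectors_up[OF z, of j k] \<open>z k < c\<close> k by simp
    then show False
      using other[of j] \<open>z k < c\<close> j k by auto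
  qed
  moreover have "z (c - 1) \<le> Suc k"
    using le[of "c - 1"] k by (auto simp: least_vec_def split: if_splits)
  ultimately have "z i \<le> least_vec n (c - 1) (Suc k) i" if "0 < i" "i < n" for i
    using other[of i] that k by (cases "i = k"; cases "Suc i = c") (auto simp: least_vec_def)
  then show ?thesis
    by (simp add: vectors_le_iff[OF z])
qed

lemma least_vec_join_irreducible:
  assumes k: "0 < k" "k < n" and c: "2 \<le> c" "c \<le> n"
  shows "least_vec n k c \<in> join_irreducibles (vectors n) (\<le>)"
proof (cases "c \<le> k")
  case True
  let ?y = "least_vec n (c - 1) (Suc k)"
  have "?y \<le> least_vec n k c"
    using k c True by (auto simp: le_fun_def least_vec_def)
  moreover have "?y k \<noteq> least_vec n k c k"
    using k c True by (auto simp: least_vec_def)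
  ultimately have "?y < least_vec n k c"
    by (metis order.strict_iff_order)
  moreover have "least_vec n k c \<in> vectors n" "?y \<in> vectors n"
    using k c True by (auto intro!: least_vec_in_vectors)
  ultimately show ?thesis
    using below_least_vec_up k c True by (blast intro: join_irreducibleI)
next
  case False
  let ?y = "least_vec n k (if c = Suc k then 1 else c - 1)"
  have "?y \<le> least_vec n k c"
    using k c False by (auto simp: le_fun_def least_vec_def)
  moreover have "?y k \<noteq> least_vec n k c k"
    using k c False by (auto simp: least_vec_def)
  ultimately have "?y < least_vec n k c"
    by (metis order.strict_iff_order)
  moreover have "least_vec n k c \<in> vectors n" "?y \<in> vectors n"
    using k c False by (auto intro!: least_vec_in_vectors)
  moreover have "z \<le> ?y" if "z \<in> vectors n" "z < least_vec n k c" for z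
    using below_least_vec_left[OF that(1) k(1) _ c(2) that(2)] False by simp
  ultimately show ?thesis
    by (blast intro: join_irreducibleI)
qed

text \<open>If \<open>k \<noteq> k'\<close>, the entry of each vector at its own index would have to
  be the second entry above 1 of the other vector, which gives both \<open>k' < k\<close> and
  \<open>k < k'\<close>.\<close>

lemma least_vec_inj:
  "inj_on (\<lambda>(k, c). least_vec n k c) ({1..<n} \<times> {2..n})"
proof -
  have "k = k' \<and> c = c'"
    if k: "0 < k" "k < n" and k': "0 < k'" "k' < n" and c: "2 \<le> c" "2 \<le> c'"
      and eq: "least_vec n k c = least_vec n k' c'" for k k' c c'
  proof (cases "k = k'")
    case True
    then show ?thesis
      using fun_cong[OF eq, of k] k by (simp add: least_vec_def)
  next
    case False
    then have "c = (if c' \<le> k' \<and> Suc k = c' then Suc k' else 1)"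
      using fun_cong[OF eq, of k] k by (simp add: least_vec_def)
    then have 1: "c = Suc k'" "c' \<le> k'" "c' = Suc k"
      using c by (auto split: if_splits)
    from False have "c' = (if c \<le> k \<and> Suc k' = c then Suc k else 1)"
      using fun_cong[OF eq, of k'] k' by (simp add: least_vec_def)
    then have "c \<le> k"
      using c by (auto split: if_splits)
    with 1 show ?thesis
      by simp
  qed
  then show ?thesis
    by (auto simp: inj_on_def Suc_le_eq)
qed

lemma card_join_irreducibles_vectors:
  "card (join_irreducibles (vectors n) (\<le>)) = (n - 1)\<^sup>2"
proof -
  have "join_irreducibles (vectors n) (\<le>) \<subseteq> (\<lambda>(k, c). least_vec n k c) ` ({1..<n} \<times> {2..n})"
  proof
    fix x assume x: "x \<in> join_irreducibles (vectors n) (\<le>)"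
    then have xv: "x \<in> vectors n"
      by (simp add: join_irreducibles_def)
    obtain k where k: "0 < k" "k < n" "2 \<le> x k" "x = least_vec n k (x k)"
      using x by (rule vectors_eq_least_vec)
    then have "(k, x k) \<in> {1..<n} \<times> {2..n}"
      using vectors_range[OF xv] by simp
    then show "x \<in> (\<lambda>(k, c). least_vec n k c) ` ({1..<n} \<times> {2..n})"
      by (rule rev_image_eqI) (simp add: k(4)[symmetric])
  qed
  moreover have "(\<lambda>(k, c). least_vec n k c) ` ({1..<n} \<times> {2..n})
      \<subseteq> join_irreducibles (vectors n) (\<le>)"
    by (auto intro!: least_vec_join_irreducible)
  ultimately have "card (join_irreducibles (vectors n) (\<le>)) = card ({1..<n} \<times> {2..n})"
    using card_image[OF least_vec_inj, of n] by (metis subset_antisym)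
  then show ?thesis
    by (simp add: power2_eq_square)
qed

section \<open>An order-reversing involution on vectors\<close>

definition dual_vec :: "nat \<Rightarrow> (nat \<Rightarrow> nat) \<Rightarrow> nat \<Rightarrow> nat" where
  "dual_vec n v = (\<lambda>k. if 0 < k \<and> k < n then Suc n - v (n - k) else 0)"

text \<open>On tableaux \<open>dual_vec\<close> is the reflection sending the cell
  \<open>(i, j)\<close> to \<open>(n + 1 - j, n + 1 - i)\<close>, which swaps left-arrows and
  up-arrows. Accordingly the two implications defining \<open>vectors\<close> are exchanged, now at
  the indices \<open>n - m < n - k\<close>.\<close>

lemma dual_vec_in_vectors:
  assumes v: "v \<in> vectors n"
  shows "dual_vec n v \<in> vectors n"
proof -
  have "1 \<le> dual_vec n v k \<and> dual_vec n v k \<le> n" if "0 < k" "k < n" for k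
    using vectors_range[OF v, of "n - k"] that by (auto simp: dual_vec_def)
  moreover have "dual_vec n v m = Suc k \<longrightarrow> m < dual_vec n v k"
    "dual_vec n v k = m \<longrightarrow> dual_vec n v m \<le> k" if "0 < k" "k < m" "m < n" for k m
  proof -
    define a b where "a = v (n - k)" and "b = v (n - m)"
    have a: "dual_vec n v k = Suc n - a" and b: "dual_vec n v m = Suc n - b"
      using that by (auto simp: dual_vec_def a_def b_def)
    have "a \<le> n" "b \<le> n"
      using vectors_range[OF v, of "n - k"] vectors_range[OF v, of "n - m"] that
      by (auto simp: a_def b_def)
    moreover have "a = Suc (n - m) \<Longrightarrow> n - k < b" "b = n - k \<Longrightarrow> a \<le> n - m"
      using vectors_up[OF v, of "n - m" "n - k"] vectors_left[OF v, of "n - m" "n - k"] that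
      by (auto simp: a_def b_def)
    ultimately show "dual_vec n v m = Suc k \<longrightarrow> m < dual_vec n v k"
      "dual_vec n v k = m \<longrightarrow> dual_vec n v m \<le> k"
      unfolding a b using that by linarith+
  qed
  ultimately show ?thesis
    unfolding vectors_def by (auto simp: dual_vec_def[of n v])
qed

lemma dual_vec_dual_vec:
  assumes v: "v \<in> vectors n"
  shows "dual_vec n (dual_vec n v) = v"
proof
  fix k
  show "dual_vec n (dual_vec n v) k = v k"
    using vectors_range[OF v, of k] vectors_outside[OF v, of k] by (auto simp: dual_vec_def)
qed

lemma dual_vec_bij: "bij_betw (dual_vec n) (vectors n) (vectors n)"
  by (rule bij_betw_byWitness[where f' = "dual_vec n"])
    (auto simp: dual_vec_dual_vec dual_vec_in_vectors)

lemma dual_vec_antimono: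
  assumes "v \<le> w"
  shows "dual_vec n w \<le> dual_vec n v"
  using assms by (auto simp: le_fun_def dual_vec_def intro: diff_le_mono2)

lemma dual_vec_le_iff:
  assumes "v \<in> vectors n" "w \<in> vectors n"
  shows "dual_vec n v \<le> dual_vec n w \<longleftrightarrow> w \<le> v"
  using dual_vec_antimono[of w v n] dual_vec_antimono[of "dual_vec n v" "dual_vec n w" n] assms
  by (auto simp: dual_vec_dual_vec)

section \<open>Small tableaux as vectors\<close>

lemma mem_board:
  "(i, j) \<in> board n \<longleftrightarrow> 0 < i \<and> i \<le> n \<and> 0 < j \<and> j \<le> n \<and> i \<le> Suc j"
  by (auto simp: board_def)

text \<open>\<open>fb_tableau\<close> requires a nonempty cell to the left or above, and the absence
  of dots other than the root forbids having both. The inequality of truth values is this exclusive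
  or.\<close>

lemma small_iff:
  "small n T \<longleftrightarrow> T \<subseteq> board n \<and> root n \<in> T \<and> border n \<subseteq> T \<and>
     (\<forall>c\<in>T - {root n}. (\<exists>d\<in>T. left_of d c) \<noteq> (\<exists>d\<in>T. above d c))"
  unfolding small_def fb_tableau_def dot_def left_arrow_def up_arrow_def
  by blast

definition vec_tableau :: "nat \<Rightarrow> (nat \<Rightarrow> nat) \<Rightarrow> cell set" where
  "vec_tableau n v = insert (root n) (border n \<union>
     (\<lambda>k. if v k \<le> k then (v k, k) else (Suc k, v k)) ` {1..<n})"

lemma mem_vec_tableau:
  "(i, j) \<in> vec_tableau n v \<longleftrightarrow>
     i = 1 \<and> j = n \<or>
     (\<exists>k. 0 < k \<and> k < n \<and> i = Suc k \<and> (j = k \<or> k < v k \<and> j = v k)) \<or>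
     0 < j \<and> j < n \<and> v j \<le> j \<and> i = v j"
proof -
  have "(i, j) \<in> border n \<longleftrightarrow> (\<exists>k. 0 < k \<and> k < n \<and> i = Suc k \<and> j = k)"
    by (auto simp: border_def intro!: exI[of _ "i - 1"])
  moreover have "(i, j) \<in> (\<lambda>k. if v k \<le> k then (v k, k) else (Suc k, v k)) ` {1..<n} \<longleftrightarrow>
      0 < j \<and> j < n \<and> v j \<le> j \<and> i = v j \<or> (\<exists>k. 0 < k \<and> k < n \<and> i = Suc k \<and> k < v k \<and> j = v k)"
    by (force simp: image_iff Bex_def split: if_splits)
  ultimately show ?thesis
    unfolding vec_tableau_def root_def by auto
qed

text \<open>Besides its border cell and possibly \<open>(Suc k, v k)\<close>, row
  \<open>Suc k\<close> contains only up-arrows of columns \<open>j\<close> with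
  \<open>v j = Suc k\<close>; \<open>vectors_up\<close> puts them strictly to the right of column
  \<open>v k\<close>.\<close>

lemma mem_vec_tableau_row:
  assumes v: "v \<in> vectors n" and k: "0 < k" "k < n"
  shows "(Suc k, j) \<in> vec_tableau n v \<Longrightarrow> j \<le> max k (v k)"
    and "(Suc k, max k (v k)) \<in> vec_tableau n v"
proof -
  assume "(Suc k, j) \<in> vec_tableau n v"
  then consider "j = k" | "j = v k" | "j < n" "v j = Suc k" "v j \<le> j"
    using k by (auto simp: mem_vec_tableau)
  then show "j \<le> max k (v k)"
    using vectors_up[OF v k(1), of j] by cases auto
next
  show "(Suc k, max k (v k)) \<in> vec_tableau n v"
    using k by (auto simp: mem_vec_tableau max_def)
qed

text \<open>Mirror image of the row case: left-arrows in column \<open>k\<close> come from rows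
  \<open>Suc m\<close> with \<open>v m = k\<close>, and \<open>vectors_left\<close> puts them
  strictly below row \<open>v k\<close>.\<close>

lemma mem_vec_tableau_col:
  assumes v: "v \<in> vectors n" and k: "0 < k" "k < n"
  shows "(i, k) \<in> vec_tableau n v \<Longrightarrow> min (Suc k) (v k) \<le> i"
    and "(min (Suc k) (v k), k) \<in> vec_tableau n v"
proof -
  assume "(i, k) \<in> vec_tableau n v"
  then consider "i = Suc k" | "i = v k" | m where "0 < m" "m < k" "v m = k" "i = Suc m"
    using k by (auto simp: mem_vec_tableau)
  then show "min (Suc k) (v k) \<le> i"
    using vectors_left[OF v _ _ k(2)] by cases (auto intro: min.coboundedI2 le_SucI)
next
  show "(min (Suc k) (v k), k) \<in> vec_tableau n v"
    using k by (auto simp: mem_vec_tableau min_def)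
qed

lemma vec_tableau_subset_board:
  assumes n: "0 < n" and v: "v \<in> vectors n"
  shows "vec_tableau n v \<subseteq> board n"
proof clarify
  fix i j assume "(i, j) \<in> vec_tableau n v"
  then consider "i = 1" "j = n" | k where "0 < k" "k < n" "i = Suc k" "j = k"
    | k where "0 < k" "k < n" "i = Suc k" "k < v k" "j = v k" | "0 < j" "j < n" "v j \<le> j" "i = v j"
    unfolding mem_vec_tableau by blast
  then show "(i, j) \<in> board n"
    using n by cases (use vectors_range[OF v] in \<open>auto simp: mem_board Suc_le_eq\<close>)
qed

text \<open>The column of the leftmost nonempty cell of row \<open>i\<close>, and the row of the topmost one of column \<open>j\<close>.\<close>

definition row_start :: "nat \<Rightarrow> (nat \<Rightarrow> nat) \<Rightarrow> nat \<Rightarrow> nat" where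
  "row_start n v i = (if i = 1 then n else max (i - 1) (v (i - 1)))"

definition col_start :: "nat \<Rightarrow> (nat \<Rightarrow> nat) \<Rightarrow> nat \<Rightarrow> nat" where
  "col_start n v j = (if j = n then 1 else min (Suc j) (v j))"

lemma row_start_mem:
  assumes "v \<in> vectors n" "0 < i" "i \<le> n"
  shows "(i, row_start n v i) \<in> vec_tableau n v"
proof (cases "i = 1")
  case False
  then obtain k where "i = Suc k" "0 < k"
    using assms(2) by (cases i) auto
  then show ?thesis
    using mem_vec_tableau_row(2)[OF assms(1), of k] assms(3) by (simp add: row_start_def)
qed (simp add: row_start_def mem_vec_tableau)

lemma le_row_start:
  assumes "v \<in> vectors n" "0 < n" "(i, j) \<in> vec_tableau n v"
  shows "j \<le> row_start n v i"
proof -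
  have b: "0 < i" "i \<le> n" "j \<le> n"
    using vec_tableau_subset_board[OF assms(2,1)] assms(3) mem_board by blast+
  show ?thesis
  proof (cases "i = 1")
    case False
    then obtain k where "i = Suc k" "0 < k"
      using b by (cases i) auto
    then show ?thesis
      using mem_vec_tableau_row(1)[OF assms(1), of k j] assms(3) b by (simp add: row_start_def)
  qed (simp add: row_start_def b)
qed

lemma col_start_mem:
  assumes "v \<in> vectors n" "0 < j" "j \<le> n"
  shows "(col_start n v j, j) \<in> vec_tableau n v"
  using assms mem_vec_tableau_col(2)[OF assms(1), of j]
  by (cases "j = n") (auto simp: col_start_def mem_vec_tableau)

lemma col_start_le:
  assumes "v \<in> vectors n" "0 < n" "(i, j) \<in> vec_tableau n v"
  shows "col_start n v j \<le> i"
proof -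
  have b: "0 < i" "0 < j" "j \<le> n"
    using vec_tableau_subset_board[OF assms(2,1)] assms(3) mem_board by blast+
  then show ?thesis
    using mem_vec_tableau_col(1)[OF assms(1), of j i] assms(3)
    by (cases "j = n") (auto simp: col_start_def)
qed

section \<open>Arrows and the sets \<open>Row\<close> and \<open>Col\<close>\<close>

lemma ex_left_of_iff:
  assumes "v \<in> vectors n" "0 < i" "i \<le> n"
  shows "(\<exists>d\<in>vec_tableau n v. left_of d (i, j)) \<longleftrightarrow> j < row_start n v i"
  using row_start_mem[OF assms] le_row_start[OF assms(1)] assms(2,3)
  by (force simp: left_of_def)

lemma ex_above_iff:
  assumes "v \<in> vectors n" "0 < j" "j \<le> n"
  shows "(\<exists>d\<in>vec_tableau n v. above d (i, j)) \<longleftrightarrow> col_start n v j < i"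
  using col_start_mem[OF assms] col_start_le[OF assms(1)] assms(2,3)
  by (force simp: above_def)

text \<open>Adjoining the root gives row 1 a start as well, so one formula describes all rows; the
  same disjunction occurs in \<open>Row\<close>.\<close>

lemma left_arrow_vec_tableau:
  assumes v: "v \<in> vectors n" and n: "0 < n"
  shows "left_arrow n (vec_tableau n v) (i, j) \<or> (i, j) = root n \<longleftrightarrow>
    0 < i \<and> i \<le> n \<and> j = row_start n v i"
proof
  assume "left_arrow n (vec_tableau n v) (i, j) \<or> (i, j) = root n"
  then show "0 < i \<and> i \<le> n \<and> j = row_start n v i"
  proof
    assume l: "left_arrow n (vec_tableau n v) (i, j)"
    then have m: "(i, j) \<in> vec_tableau n v"
      by (simp add: left_arrow_def)
    then have i: "0 < i" "i \<le> n"
      using vec_tableau_subset_board[OF n v] mem_board by blast+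
    then show ?thesis
      using le_row_start[OF v n m] ex_left_of_iff[OF v i, of j] l by (auto simp: left_arrow_def)
  qed (use n in \<open>auto simp: root_def row_start_def\<close>)
next
  assume i: "0 < i \<and> i \<le> n \<and> j = row_start n v i"
  then show "left_arrow n (vec_tableau n v) (i, j) \<or> (i, j) = root n"
    using row_start_mem[OF v, of i] ex_left_of_iff[OF v, of i j] by (auto simp: left_arrow_def)
qed

lemma up_arrow_vec_tableau:
  assumes v: "v \<in> vectors n" and n: "0 < n"
  shows "up_arrow n (vec_tableau n v) (i, j) \<or> (i, j) = root n \<longleftrightarrow>
    0 < j \<and> j \<le> n \<and> i = col_start n v j"
proof
  assume "up_arrow n (vec_tableau n v) (i, j) \<or> (i, j) = root n"
  then show "0 < j \<and> j \<le> n \<and> i = col_start n v j"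
  proof
    assume l: "up_arrow n (vec_tableau n v) (i, j)"
    then have m: "(i, j) \<in> vec_tableau n v"
      by (simp add: up_arrow_def)
    then have j: "0 < j" "j \<le> n"
      using vec_tableau_subset_board[OF n v] mem_board by blast+
    then show ?thesis
      using col_start_le[OF v n m] ex_above_iff[OF v j, of i] l by (auto simp: up_arrow_def)
  qed (use n in \<open>auto simp: root_def col_start_def\<close>)
next
  assume j: "0 < j \<and> j \<le> n \<and> i = col_start n v j"
  then show "up_arrow n (vec_tableau n v) (i, j) \<or> (i, j) = root n"
    using col_start_mem[OF v, of j] ex_above_iff[OF v, of j i] by (auto simp: up_arrow_def)
qed

lemma mem_Row_vec_tableau:
  assumes "v \<in> vectors n" "0 < n"
  shows "(i, j) \<in> Row n (vec_tableau n v) \<longleftrightarrow> (i, j) \<in> board n \<and> j \<le> row_start n v i"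
proof -
  have "(i, j) \<in> Row n (vec_tableau n v) \<longleftrightarrow> (i, j) \<in> board n \<and>
      (\<exists>i' j'. (left_arrow n (vec_tableau n v) (i', j') \<or> (i', j') = root n) \<and> i' = i \<and> j \<le> j')"
    by (auto simp: Row_def left_of_def) (metis order.strict_iff_order)+
  then show ?thesis
    unfolding left_arrow_vec_tableau[OF assms] by (auto simp: mem_board)
qed

lemma mem_Col_vec_tableau:
  assumes "v \<in> vectors n" "0 < n"
  shows "(i, j) \<in> Col n (vec_tableau n v) \<longleftrightarrow> (i, j) \<in> board n \<and> col_start n v j \<le> i"
proof -
  have "(i, j) \<in> Col n (vec_tableau n v) \<longleftrightarrow> (i, j) \<in> board n \<and>
      (\<exists>i' j'. (up_arrow n (vec_tableau n v) (i', j') \<or> (i', j') = root n) \<and> j' = j \<and> i' \<le> i)"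
    by (auto simp: Col_def above_def) (metis order.strict_iff_order)+
  then show ?thesis
    unfolding up_arrow_vec_tableau[OF assms] by (auto simp: mem_board)
qed

text \<open>A border cell has a nonempty cell to its left if \<open>k < v k\<close> and one above it
  otherwise. For the other left-arrows the required cell above comes from
  \<open>vectors_left\<close>, for the other up-arrows the required cell to the left comes from
  \<open>vectors_up\<close>; in column \<open>n\<close> and in row 1 the root supplies it.\<close>

lemma vec_tableau_small:
  assumes v: "v \<in> vectors n" and n: "0 < n"
  shows "small n (vec_tableau n v)"
proof -
  have "(\<exists>d\<in>vec_tableau n v. left_of d (i, j)) \<noteq> (\<exists>d\<in>vec_tableau n v. above d (i, j))"
    if m: "(i, j) \<in> vec_tableau n v" and r: "(i, j) \<noteq> root n" for i j
  proof -
    have b: "0 < i" "i \<le> n" "0 < j" "j \<le> n"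
      using vec_tableau_subset_board[OF n v] m mem_board by blast+
    consider k where "0 < k" "k < n" "i = Suc k" "j = k"
      | k where "0 < k" "k < n" "i = Suc k" "k < v k" "j = v k"
      | "0 < j" "j < n" "v j \<le> j" "i = v j"
      using m r unfolding mem_vec_tableau by (auto simp: root_def)
    then have "j < row_start n v i \<longleftrightarrow> \<not> col_start n v j < i"
    proof cases
      case (1 k)
      then show ?thesis
        by (auto simp: row_start_def col_start_def)
    next
      case (2 k)
      have "row_start n v i = j"
        using 2 by (simp add: row_start_def)
      moreover have "col_start n v j < i"
      proof (cases "j = n")
        case True
        then show ?thesis
          using 2 by (simp add: col_start_def)
      next
        case False
        then have "v j \<le> k"
          using vectors_left[OF v 2(1,4) _ refl] False b(4) 2(5) by simp
        then show ?thesis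
          using False 2(3) by (simp add: col_start_def)
      qed
      ultimately show ?thesis
        by simp
    next
      case 3
      show ?thesis
      proof (cases "i = 1")
        case True
        then have "v j = 1"
          using 3(4) by linarith
        with True 3(1,2) show ?thesis
          by (simp add: row_start_def col_start_def)
      next
        case False
        then obtain k where k: "i = Suc k" "0 < k"
          using b by (cases i) auto
        then have "v j = Suc k"
          using 3(4) by linarith
        moreover from this have "j < v k"
          using vectors_up[OF v k(2) _ 3(2)] 3(3) by simp
        ultimately show ?thesis
          using k 3(2,3) by (simp add: row_start_def col_start_def)
      qed
    qed
    then show ?thesis
      unfolding ex_left_of_iff[OF v b(1,2)] ex_above_iff[OF v b(3,4)] by blast
  qed
  moreover have "root n \<in> vec_tableau n v" "border n \<subseteq> vec_tableau n v"
    unfolding vec_tableau_def by blast+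
  ultimately show ?thesis
    unfolding small_iff using vec_tableau_subset_board[OF n v] by (metis DiffD1 DiffD2 singletonI surj_pair)
qed

section \<open>From small tableaux back to vectors\<close>

text \<open>The exclusive or of \<open>small_iff\<close> at the border cell
  \<open>(Suc k, k)\<close> decides between the two cases. The witness \<open>x\<close> becomes the
  entry \<open>v k\<close> of the vector.\<close>

lemma small_fork:
  assumes T: "small n T" and k: "0 < k" "k < n"
  obtains x where "1 \<le> x" "x \<le> k" "(x, k) \<in> T" "\<And>i. (i, k) \<in> T \<Longrightarrow> x \<le> i"
      "\<And>j. (Suc k, j) \<in> T \<Longrightarrow> j \<le> k"
    | x where "k < x" "x \<le> n" "(Suc k, x) \<in> T" "\<And>j. (Suc k, j) \<in> T \<Longrightarrow> j \<le> x"
      "\<And>i. (i, k) \<in> T \<Longrightarrow> k < i"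
proof -
  have T': "T \<subseteq> board n" "border n \<subseteq> T"
    "\<And>c. c \<in> T \<Longrightarrow> c \<noteq> root n \<Longrightarrow> (\<exists>d\<in>T. left_of d c) \<noteq> (\<exists>d\<in>T. above d c)"
    using T by (auto simp: small_iff)
  have "(Suc k, k) \<in> border n"
    using k by (auto simp: border_def)
  then have alt: "(\<exists>d\<in>T. left_of d (Suc k, k)) \<noteq> (\<exists>d\<in>T. above d (Suc k, k))"
    using T'(2) k by (intro T'(3)) (auto simp: root_def)
  show ?thesis
  proof (cases "\<exists>d\<in>T. above d (Suc k, k)")
    case True
    then obtain i where i: "(i, k) \<in> T" "i \<le> k"
      by (auto simp: above_def)
    define x where "x = (LEAST i. (i, k) \<in> T)"
    have x: "(x, k) \<in> T" "\<And>i. (i, k) \<in> T \<Longrightarrow> x \<le> i"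
      unfolding x_def using i by (auto intro: LeastI Least_le)
    moreover have "1 \<le> x"
      using x(1) T'(1) mem_board[of x k n] by auto
    moreover have "j \<le> k" if "(Suc k, j) \<in> T" for j
    proof (rule ccontr)
      assume "\<not> j \<le> k"
      with that have "\<exists>d\<in>T. left_of d (Suc k, k)"
        by (force simp: left_of_def)
      with alt True show False
        by blast
    qed
    ultimately show ?thesis
      using i le_trans by (intro that(1)) blast+
  next
    case False
    with alt obtain j where j: "(Suc k, j) \<in> T" "k < j"
      by (auto simp: left_of_def)
    have bound: "j \<le> n" if "(Suc k, j) \<in> T" for j
      using that T'(1) mem_board[of "Suc k" j n] by auto
    define x where "x = (GREATEST j. (Suc k, j) \<in> T)"
    have x: "(Suc k, x) \<in> T" "\<And>j. (Suc k, j) \<in> T \<Longrightarrow> j \<le> x"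
      using GreatestI_nat[of "\<lambda>j. (Suc k, j) \<in> T" j n]
        Greatest_le_nat[of "\<lambda>j. (Suc k, j) \<in> T" _ n] j(1) bound
      unfolding x_def by blast+
    moreover have "k < i" if "(i, k) \<in> T" for i
      using that False by (force simp: above_def)
    moreover have "k < x"
      using x(2)[OF j(1)] j(2) by simp
    ultimately show ?thesis
      using bound by (intro that(2)) blast+
  qed
qed

lemma small_eq_vec_tableau:
  assumes T: "small n T"
  obtains v where "v \<in> vectors n" "T = vec_tableau n v"
proof -
  have T': "T \<subseteq> board n" "border n \<subseteq> T" "root n \<in> T"
    and alt: "\<And>c. c \<in> T \<Longrightarrow> c \<noteq> root n \<Longrightarrow> (\<exists>d\<in>T. left_of d c) \<noteq> (\<exists>d\<in>T. above d c)"
    using T by (auto simp: small_iff)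
  have bd: "0 < i" "i \<le> n" "0 < j" "j \<le> n" "i \<le> Suc j" if "(i, j) \<in> T" for i j
    using that T'(1) mem_board by blast+
  let ?P = "\<lambda>k x. 1 \<le> x \<and> x \<le> k \<and> (x, k) \<in> T \<and> (\<forall>i. (i, k) \<in> T \<longrightarrow> x \<le> i) \<and>
      (\<forall>j. (Suc k, j) \<in> T \<longrightarrow> j \<le> k)"
  let ?Q = "\<lambda>k x. k < x \<and> x \<le> n \<and> (Suc k, x) \<in> T \<and> (\<forall>j. (Suc k, j) \<in> T \<longrightarrow> j \<le> x) \<and>
      (\<forall>i. (i, k) \<in> T \<longrightarrow> k < i)"
  have "\<exists>x. ?P k x \<or> ?Q k x" if "0 < k" "k < n" for k
    using T that by (rule small_fork) blast+
  then have "\<forall>k\<in>{0<..<n}. \<exists>x. ?P k x \<or> ?Q k x"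
    by (intro ballI) (simp only: greaterThanLessThan_iff)
  from bchoice[OF this] obtain u where u: "\<forall>k\<in>{0<..<n}. ?P k (u k) \<or> ?Q k (u k)" ..
  \<comment> \<open>The chosen \<open>u\<close> is arbitrary outside the index range, whereas a
    vector has to vanish there.\<close>
  define v where "v = (\<lambda>k. if 0 < k \<and> k < n then u k else 0)"
  have fork: "?P k (v k) \<or> ?Q k (v k)" if "0 < k" "k < n" for k
  proof -
    have "v k = u k"
      using that by (simp add: v_def)
    then show ?thesis
      using u that by (simp only: greaterThanLessThan_iff Ball_def)
  qed
  have P: "?P k (v k)" if "0 < k" "k < n" "v k \<le> k" for k
    using fork[OF that(1,2)] that(3) by auto
  have Q: "?Q k (v k)" if "0 < k" "k < n" "k < v k" for k
    using fork[OF that(1,2)] that(3) by auto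
  have row: "k < v k" "j \<le> v k" if "0 < k" "k < n" "(Suc k, j) \<in> T" "k < j" for k j
    using fork[OF that(1,2)] that(3,4) by auto
  have col: "v k \<le> i" if "0 < k" "k < n" "(i, k) \<in> T" "i \<le> k" for k i
    using fork[OF that(1,2)] that(3,4) by auto
  have "v \<in> vectors n"
    unfolding vectors_def
  proof (intro CollectI conjI allI impI)
    \<comment> \<open>Both implications come from the exclusive or at the cell
      \<open>(Suc k, m)\<close>: topmost in its column, it needs a cell to its left; leftmost in its
      row, it needs a cell above.\<close>
    fix k m assume km: "0 < k \<and> k < m \<and> m < n"
    {
      assume eq: "v m = Suc k"
      then have Pm: "?P m (v m)"
        using km by (intro P) auto
      then have "\<not> (\<exists>d\<in>T. above d (Suc k, m))"
        by (force simp: above_def eq)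
      then obtain j where "(Suc k, j) \<in> T" "m < j"
        using alt[of "(Suc k, m)"] Pm km by (auto simp: eq root_def left_of_def)
      then show "m < v k"
        using row[of k j] km by simp
    }
    {
      assume eq: "v k = m"
      then have Qk: "?Q k (v k)"
        using km by (intro Q) auto
      then have "\<not> (\<exists>d\<in>T. left_of d (Suc k, m))"
        by (force simp: left_of_def eq)
      then obtain i where "(i, m) \<in> T" "i < Suc k"
        using alt[of "(Suc k, m)"] Qk km by (auto simp: eq root_def above_def)
      then show "v m \<le> k"
        using col[of m i] km by simp
    }
  next
    fix k assume "0 < k \<and> k < n"
    then show "1 \<le> v k" "v k \<le> n"
      using fork[of k] by auto
  qed (auto simp: v_def)
  moreover have "T = vec_tableau n v"
  proof (intro equalityI subsetI; clarify)
    fix i j assume m: "(i, j) \<in> T"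
    note b = bd[OF m]
    show "(i, j) \<in> vec_tableau n v"
    proof (cases "(i, j) = root n \<or> i = Suc j")
      case True
      then show ?thesis
        using b by (auto simp: mem_vec_tableau root_def)
    next
      case False
      \<comment> \<open>A cell that is neither the root nor on the border is leftmost in its row,
        and then it is \<open>(Suc k, v k)\<close>, or topmost in its column, and then it is
        \<open>(v j, j)\<close>.\<close>
      then consider "\<not> (\<exists>d\<in>T. left_of d (i, j))" | "\<not> (\<exists>d\<in>T. above d (i, j))"
        using alt[OF m] by blast
      then show ?thesis
      proof cases
        case 1
        then have "i \<noteq> 1"
          using T'(3) False b by (force simp: root_def left_of_def)
        then obtain k where k: "i = Suc k" "0 < k"
          using b by (cases i) auto
        then have "k < v k" "j \<le> v k"
          using row[of k j] False b m by auto
        moreover have "v k \<le> j"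
          using Q[of k] \<open>k < v k\<close> k b 1 by (force simp: left_of_def)
        ultimately show ?thesis
          using k b by (simp add: mem_vec_tableau)
      next
        case 2
        then have "j \<noteq> n"
          using T'(3) False b by (force simp: root_def above_def)
        then have "v j \<le> i"
          using col[of j i] False b m by auto
        moreover have "i \<le> v j"
          using P[of j] \<open>v j \<le> i\<close> \<open>j \<noteq> n\<close> False b 2 by (force simp: above_def)
        ultimately show ?thesis
          using \<open>j \<noteq> n\<close> b False by (simp add: mem_vec_tableau)
      qed
    qed
  next
    fix i j assume "(i, j) \<in> vec_tableau n v"
    then consider "i = 1" "j = n" | k where "0 < k" "k < n" "i = Suc k" "j = k"
      | k where "0 < k" "k < n" "i = Suc k" "k < v k" "j = v k"
      | "0 < j" "j < n" "v j \<le> j" "i = v j"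
      unfolding mem_vec_tableau by blast
    then show "(i, j) \<in> T"
    proof cases
      case 1
      then show ?thesis
        using T'(3) by (simp add: root_def)
    next
      case (2 k)
      then have "(i, j) \<in> border n"
        by (auto simp: border_def)
      then show ?thesis
        using T'(2) by blast
    next
      case (3 k)
      then show ?thesis
        using Q[of k] by simp
    next
      case 4
      then show ?thesis
        unfolding 4(4) using P[OF 4(1-3)] by blast
    qed
  qed
  ultimately show ?thesis
    by (rule that)
qed

section \<open>The order on small tableaux\<close>

lemma fb_le_small:
  assumes "small n S" "small n T"
  shows "fb_le n S T \<longleftrightarrow> Col n S \<subseteq> Col n T \<and> Row n T \<subseteq> Row n S"
proof -
  \<comment> \<open>The only dot of \<open>S\<close> is the root, which is also a dot of
    \<open>T\<close>; this gives the condition on free cells.\<close>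
  have "dot n T c" if "dot n S c" for c
  proof -
    have "c = root n"
      using that assms(1) by (auto simp: small_def)
    then show ?thesis
      using assms(2) by (auto simp: small_def)
  qed
  then show ?thesis
    unfolding fb_le_def by blast
qed

text \<open>Inclusion of the \<open>Row\<close> sets compares row starts, that is, entries cut off
  below at \<open>k\<close>; inclusion of the \<open>Col\<close> sets compares column starts, that
  is, entries cut off above at \<open>Suc k\<close>.\<close>

lemma fb_le_vec_tableau:
  assumes v: "v \<in> vectors n" and w: "w \<in> vectors n" and n: "0 < n"
  shows "fb_le n (vec_tableau n v) (vec_tableau n w) \<longleftrightarrow> w \<le> v"
proof -
  have "Row n (vec_tableau n w) \<subseteq> Row n (vec_tableau n v) \<longleftrightarrow>
      (\<forall>k. 0 < k \<and> k < n \<longrightarrow> max k (w k) \<le> max k (v k))"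
  proof (intro iffI allI impI)
    fix k assume "Row n (vec_tableau n w) \<subseteq> Row n (vec_tableau n v)" and k: "0 < k \<and> k < n"
    moreover have "(Suc k, max k (w k)) \<in> Row n (vec_tableau n w)"
      using k vectors_range[OF w, of k] by (simp add: mem_Row_vec_tableau[OF w n] mem_board row_start_def)
    ultimately have "(Suc k, max k (w k)) \<in> Row n (vec_tableau n v)"
      by blast
    then show "max k (w k) \<le> max k (v k)"
      using k by (simp add: mem_Row_vec_tableau[OF v n] row_start_def)
  next
    assume le: "\<forall>k. 0 < k \<and> k < n \<longrightarrow> max k (w k) \<le> max k (v k)"
    have start: "row_start n w i \<le> row_start n v i" if "0 < i" "i \<le> n" for i
      using le[rule_format, of "i - 1"] that by (auto simp: row_start_def)
    show "Row n (vec_tableau n w) \<subseteq> Row n (vec_tableau n v)"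
    proof clarify
      fix i j assume m: "(i, j) \<in> Row n (vec_tableau n w)"
      then have "0 < i" "i \<le> n" "0 < j" "j \<le> n"
        by (auto simp: mem_Row_vec_tableau[OF w n] mem_board)
      with m show "(i, j) \<in> Row n (vec_tableau n v)"
        using start[of i] by (simp add: mem_Row_vec_tableau[OF v n] mem_Row_vec_tableau[OF w n])
    qed
  qed
  moreover have "Col n (vec_tableau n v) \<subseteq> Col n (vec_tableau n w) \<longleftrightarrow>
      (\<forall>k. 0 < k \<and> k < n \<longrightarrow> min (Suc k) (w k) \<le> min (Suc k) (v k))"
  proof (intro iffI allI impI)
    fix k assume "Col n (vec_tableau n v) \<subseteq> Col n (vec_tableau n w)" and k: "0 < k \<and> k < n"
    moreover have "(min (Suc k) (v k), k) \<in> Col n (vec_tableau n v)"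
      using k vectors_range[OF v, of k] by (simp add: mem_Col_vec_tableau[OF v n] mem_board col_start_def)
    ultimately have "(min (Suc k) (v k), k) \<in> Col n (vec_tableau n w)"
      by blast
    then show "min (Suc k) (w k) \<le> min (Suc k) (v k)"
      using k by (simp add: mem_Col_vec_tableau[OF w n] col_start_def)
  next
    assume le: "\<forall>k. 0 < k \<and> k < n \<longrightarrow> min (Suc k) (w k) \<le> min (Suc k) (v k)"
    have start: "col_start n w j \<le> col_start n v j" if "0 < j" "j \<le> n" for j
      using le[rule_format, of j] that by (auto simp: col_start_def)
    show "Col n (vec_tableau n v) \<subseteq> Col n (vec_tableau n w)"
    proof clarify
      fix i j assume m: "(i, j) \<in> Col n (vec_tableau n v)"
      then have "0 < i" "i \<le> n" "0 < j" "j \<le> n"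
        by (auto simp: mem_Col_vec_tableau[OF v n] mem_board)
      with m show "(i, j) \<in> Col n (vec_tableau n w)"
        using start[of j] by (simp add: mem_Col_vec_tableau[OF v n] mem_Col_vec_tableau[OF w n])
    qed
  qed
  \<comment> \<open>If \<open>w k\<close> exceeds \<open>k\<close>, the maxima give the bound on
    \<open>w k\<close>; otherwise the minima do.\<close>
  moreover have "max k (w k) \<le> max k (v k) \<and> min (Suc k) (w k) \<le> min (Suc k) (v k) \<longleftrightarrow> w k \<le> v k" for k
    by (auto simp: max_def min_def)
  ultimately show ?thesis
    unfolding fb_le_small[OF vec_tableau_small[OF v n] vec_tableau_small[OF w n]] vectors_le_iff[OF w]
    by blast
qed

text \<open>Injectivity is read off from the order: equal tableaux are comparable both ways, so
  their vectors agree by antisymmetry.\<close>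

lemma vec_tableau_bij:
  assumes "0 < n"
  shows "bij_betw (vec_tableau n) (vectors n) (sTam n)"
proof (rule bij_betwI')
  fix v w assume v: "v \<in> vectors n" and w: "w \<in> vectors n"
  show "vec_tableau n v = vec_tableau n w \<longleftrightarrow> v = w"
    using fb_le_vec_tableau[OF v w assms] fb_le_vec_tableau[OF w v assms]
      fb_le_vec_tableau[OF v v assms] by (metis order.refl order.antisym)
next
  fix v assume "v \<in> vectors n"
  then show "vec_tableau n v \<in> sTam n"
    using vec_tableau_small assms by (simp add: sTam_def)
next
  fix T assume "T \<in> sTam n"
  then show "\<exists>v\<in>vectors n. T = vec_tableau n v"
    unfolding sTam_def using small_eq_vec_tableau by blast
qed

theorem lemma10p4:
  fixes n :: nat
  assumes "n \<ge> 1"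
  shows "card (meet_irreducibles (sTam n) (fb_le n)) = (n - 1)^2
       \<and> card (join_irreducibles (sTam n) (fb_le n)) = (n - 1)^2"
proof -
  have n: "0 < n"
    using assms by simp
  \<comment> \<open>\<open>vec_tableau\<close> reverses the order, so join-irreducible vectors
    correspond to meet-irreducible tableaux.\<close>
  have "card (join_irreducibles (vectors n) (\<le>)) = card (join_irreducibles (sTam n) (\<lambda>S T. fb_le n T S))"
    using vec_tableau_bij[OF n] by (rule card_join_irreducibles_iso) (simp add: fb_le_vec_tableau n)
  then have "card (meet_irreducibles (sTam n) (fb_le n)) = (n - 1)\<^sup>2"
    using meet_irreducibles_converse[of "sTam n" "\<lambda>S T. fb_le n T S"]
    by (simp add: card_join_irreducibles_vectors)
  \<comment> \<open>Join-irreducible tableaux correspond to the join-irreducibles of the reversed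
    order on vectors, which \<open>dual_vec\<close> carries back to the original order.\<close>
  moreover have "card (join_irreducibles (vectors n) (\<lambda>v w. w \<le> v)) = card (join_irreducibles (sTam n) (fb_le n))"
    using vec_tableau_bij[OF n] by (rule card_join_irreducibles_iso) (simp add: fb_le_vec_tableau n)
  moreover have "card (join_irreducibles (vectors n) (\<lambda>v w. w \<le> v)) = card (join_irreducibles (vectors n) (\<le>))"
    using dual_vec_bij by (rule card_join_irreducibles_iso) (simp add: dual_vec_le_iff)
  ultimately show ?thesis
    by (simp add: card_join_irreducibles_vectors)
qed

end
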